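(* Let $L>0$ and let $Z$ be a real random variable with $|Z-\mathbb E[Z]|\le L$ (almost surely). Then $Z$ is central moment bounded with parameter $L$.
   Context: A real random variable $Z$ is central moment bounded with parameter $L>0$ if for every integer $i\ge 1$, $\mathbb E[|Z-\mathbb E[Z]|^i]\le i\cdot L\cdot \mathbb E[|Z-\mathbb E[Z]|^{i-1}]$ (with $|\cdot|^0=1$). *)

theory Defs
  imports "HOL-Probability.Probability"
begin

text \<open>
  The Lebesgue integral \<^term>\<open>integral\<^sup>L M f\<close> is 0 for non-integrable \<^term>\<open>f\<close>, so the
  existence of the mean and the finiteness of the central moments are required explicitly.
  The latter is no restriction: read with values in $[0,\infty]$, the moment inequalities
  force it by induction on the order, as the moment of order 0 is 1.
\<close>

definition central_moment_bounded :: "'a measure \<Rightarrow> ('a \<Rightarrow> real) \<Rightarrow> real \<Rightarrow> bool" where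
  "central_moment_bounded M Z L \<longleftrightarrow>
     0 < L \<and> integrable M Z \<and>
     (\<forall>i::nat. i \<ge> 1 \<longrightarrow>
        integrable M (\<lambda>\<omega>. \<bar>Z \<omega> - (\<integral>\<omega>'. Z \<omega>' \<partial>M)\<bar> ^ i) \<and>
        (\<integral>\<omega>. \<bar>Z \<omega> - (\<integral>\<omega>'. Z \<omega>' \<partial>M)\<bar> ^ i \<partial>M)
          \<le> real i * L * (\<integral>\<omega>. \<bar>Z \<omega> - (\<integral>\<omega>'. Z \<omega>' \<partial>M)\<bar> ^ (i - 1) \<partial>M))"

end

theory Submission
  imports Defs
begin

text \<open>Write \<open>Y\<close> for the absolute deviation of \<open>Z\<close> from its mean.
  Almost surely 0 \<le> \<open>Y\<close> \<le> \<open>L\<close>, so peeling one factor off the power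
  gives \<open>Y ^ i\<close> \<le> \<open>L * Y ^ (i - 1)\<close> pointwise. Integrating yields the
  moment inequality even without the factor \<open>i\<close>, which only weakens the bound since
  \<open>i\<close> \<ge> 1. All integrals involved are finite because bounded measurable functions
  are integrable over a probability space.\<close>

theorem lemma7p1:
  fixes M :: "'a measure" and Z :: "'a \<Rightarrow> real" and L :: real
  assumes "prob_space M"
    and "Z \<in> borel_measurable M"
    and "L > 0"
    and "AE \<omega> in M. \<bar>Z \<omega> - (\<integral>\<omega>'. Z \<omega>' \<partial>M)\<bar> \<le> L"
  shows "central_moment_bounded M Z L"
proof -
  interpret prob_space M by fact
  note [measurable] = assms(2)
  define Y where "Y \<omega> = \<bar>Z \<omega> - (\<integral>\<omega>'. Z \<omega>' \<partial>M)\<bar>" for \<omega>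
  have [measurable]: "Y \<in> borel_measurable M"
    unfolding Y_def by measurable
  have Y_nonneg: "0 \<le> Y \<omega>" for \<omega>
    by (simp add: Y_def)
  have Y_le: "AE \<omega> in M. Y \<omega> \<le> L"
    using assms(4) by (simp add: Y_def)
  \<comment> \<open>Whatever real number the integral of \<open>Z\<close> denotes, even the default
    0, closeness to it bounds \<open>Z\<close> almost surely; hence integrability follows without
    circularity.\<close>
  have int_Z: "integrable M Z"
  proof (rule integrable_const_bound)
    show "AE \<omega> in M. norm (Z \<omega>) \<le> L + \<bar>\<integral>\<omega>'. Z \<omega>' \<partial>M\<bar>"
      using assms(4) by eventually_elim auto
  qed fact
  have int_Y: "integrable M (\<lambda>\<omega>. Y \<omega> ^ i)" for i
  proof (rule integrable_const_bound)
    show "AE \<omega> in M. norm (Y \<omega> ^ i) \<le> L ^ i"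
      using Y_le by eventually_elim (simp add: Y_nonneg power_mono)
  qed measurable
  have "(\<integral>\<omega>. Y \<omega> ^ i \<partial>M) \<le> real i * L * (\<integral>\<omega>. Y \<omega> ^ (i - 1) \<partial>M)" if "i \<ge> 1" for i
  proof -
    have "(\<integral>\<omega>. Y \<omega> ^ i \<partial>M) \<le> (\<integral>\<omega>. L * Y \<omega> ^ (i - 1) \<partial>M)"
    proof (rule integral_mono_AE)
      show "AE \<omega> in M. Y \<omega> ^ i \<le> L * Y \<omega> ^ (i - 1)"
        using Y_le
      proof eventually_elim
        case (elim \<omega>)
        \<comment> \<open>Here \<open>i\<close> \<ge> 1 matters: for \<open>i\<close> = 0 the
          truncated \<open>i - 1\<close> would make this \<open>1 = Y \<omega>\<close>.\<close>
        have "Y \<omega> ^ i = Y \<omega> * Y \<omega> ^ (i - 1)"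
          using that by (cases i) auto
        also have "\<dots> \<le> L * Y \<omega> ^ (i - 1)"
          using elim by (simp add: Y_nonneg mult_right_mono)
        finally show ?case .
      qed
    qed (simp_all add: int_Y)
    \<comment> \<open>The explicit 1 is there to be replaced by \<open>real i\<close>, which is
      monotone because the remaining factor is nonnegative.\<close>
    also have "\<dots> = 1 * (L * (\<integral>\<omega>. Y \<omega> ^ (i - 1) \<partial>M))"
      by simp
    also have "\<dots> \<le> real i * (L * (\<integral>\<omega>. Y \<omega> ^ (i - 1) \<partial>M))"
      using that \<open>L > 0\<close> by (intro mult_right_mono mult_nonneg_nonneg integral_nonneg)
        (simp_all add: Y_nonneg)
    finally show ?thesis
      by (simp add: mult.assoc)
  qed
  then show ?thesis
    using \<open>L > 0\<close> int_Z int_Y unfolding central_moment_bounded_def Y_def by blast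
qed

end
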